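(* Let $S,T,P$ be Cu-semigroups, and let $\mathbf f=(f_\lambda)_\lambda$ and $\mathbf g=(g_\lambda)_\lambda$ be paths in $\mathrm{Cu}[S,T]$ and $\mathrm{Cu}[T,P]$, respectively. For each $\lambda$, consider the generalized Cu-morphism $g_\lambda\circ f_\lambda\colon S\to P$. Then $(g_\lambda\circ f_\lambda)_\lambda$ is a path in $\mathrm{Cu}[S,P]$ and $$[\mathbf g]\circ[\mathbf f]=[(g_\lambda\circ f_\lambda)_\lambda],$$ where $\circ$ on the left denotes the composition product $[\![T,P]\!]\otimes[\![S,T]\!]\to[\![S,P]\!]$.
   Context: A positively ordered semigroup is a commutative monoid $(S,+,0)$ with a partial order $\le$ compatible with addition such that $0\le a$ for all $a$. For $a,b\in S$, $a\ll b$ (way-below) means: whenever $(c_n)_n$ is an increasing sequence in $S$ whose supremum exists and satisfies $b\le\sup_n c_n$, there is $k$ with $a\le c_k$. A Cu-semigroup is a positively ordered semigroup satisfying: (O1) every increasing sequence has a supremum; (O2) every $a$ is the supremum of a sequence $(a_n)_n$ with $a_n\ll a_{n+1}$ for all $n$; (O3) $a'\ll a$ and $b'\ll b$ imply $a'+b'\ll a+b$; (O4) $\sup_n(a_n+b_n)=\sup_n a_n+\sup_n b_n$ for increasing sequences. A generalized Cu-morphism is a map between Cu-semigroups preserving addition, zero, order and suprema of increasing sequences; a Cu-morphism additionally preserves $\ll$. $\mathrm{Cu}[S,T]$ and $\mathrm{Cu}(S,T)$ denote the sets of generalized Cu-morphisms and of Cu-morphisms $S\to T$, with pointwise order and addition.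 A Cu-bimorphism $\varphi\colon S\times T\to P$ is a map that is additive, zero- and order-preserving in each variable, satisfies $\sup_k\varphi(a_k,b_k)=\varphi(\sup_k a_k,\sup_k b_k)$ for increasing sequences, and satisfies $\varphi(a',b')\ll\varphi(a,b)$ whenever $a'\ll a$ and $b'\ll b$. $S\otimes T$ denotes the Cu-semigroup with universal Cu-bimorphism $S\times T\to S\otimes T$, $(a,b)\mapsto a\otimes b$: every Cu-bimorphism $S\times T\to P$ factors through a unique Cu-morphism $S\otimes T\to P$, and Cu-morphisms $\alpha_1,\alpha_2\colon S\otimes T\to P$ satisfy $\alpha_1\le\alpha_2$ iff $\alpha_1(a\otimes b)\le\alpha_2(a\otimes b)$ for all $a,b$. The tensor product is associative up to natural isomorphism. For Cu-morphisms $\varphi_1,\varphi_2$, $\varphi_1\otimes\varphi_2$ is the Cu-morphism with $(\varphi_1\otimes\varphi_2)(a\otimes b)=\varphi_1(a)\otimes\varphi_2(b)$. Let $I_{\mathbb Q}=\mathbb Q\cap(0,1)$. For $\varphi,\psi\in\mathrm{Cu}[S,T]$ write $\varphi\prec\psi$ if $\varphi(a')\ll\psi(a)$ whenever $a'\ll a$ in $S$. A path in $\mathrm{Cu}[S,T]$ is a family $\mathbf f=(f_\lambda)_{\lambda\in I_{\mathbb Q}}$ with $f_{\lambda'}\prec f_\lambda$ whenever $\lambda'<\lambda$. Write $\mathbf f\lesssim\mathbf g$ if for every $\lambda$ there is $\mu$ with $f_\lambda\prec g_\mu$. The internal hom $[\![S,T]\!]$ is the set of classes $[\mathbf f]$ of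 paths modulo ($\mathbf f\lesssim\mathbf g$ and $\mathbf g\lesssim\mathbf f$), with $[\mathbf f]+[\mathbf g]=[(f_\lambda+g_\lambda)_\lambda]$ and $[\mathbf f]\le[\mathbf g]$ iff $\mathbf f\lesssim\mathbf g$; it is a Cu-semigroup. The endpoint map $\sigma_{S,T}\colon[\![S,T]\!]\to\mathrm{Cu}[S,T]$ is $\sigma_{S,T}([\mathbf f])(a)=\sup_\lambda f_\lambda(a)$. It is known that for Cu-semigroups $S,T,P$ there is a bijection $\mathrm{Cu}(S,[\![T,P]\!])\cong\mathrm{Cu}(S\otimes T,P)$ sending $\alpha$ to the Cu-morphism $a\otimes b\mapsto\sigma_{T,P}(\alpha(a))(b)$. The evaluation map $\mathrm e_{S,T}\colon[\![S,T]\!]\otimes S\to T$ is the Cu-morphism corresponding to $\mathrm{id}_{[\![S,T]\!]}$. The composition product $\circ\colon[\![T,P]\!]\otimes[\![S,T]\!]\to[\![S,P]\!]$, $y\otimes x\mapsto y\circ x$, is the Cu-morphism corresponding to $\mathrm e_{T,P}\circ(\mathrm{id}_{[\![T,P]\!]}\otimes\mathrm e_{S,T})\colon[\![T,P]\!]\otimes[\![S,T]\!]\otimes S\to P$. *)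

theory Defs
  imports Complex_Main "HOL-Algebra.Group"
begin

section \<open>Cu-semigroups\<close>

record 'a posg = "'a partial_object" +
  add :: "'a \<Rightarrow> 'a \<Rightarrow> 'a" (infixl "\<oplus>\<index>" 65)
  zero :: 'a ("\<zero>\<index>")
  leq :: "'a \<Rightarrow> 'a \<Rightarrow> bool" (infix "\<preceq>\<index>" 50)

locale pos_ordered_semigroup =
  fixes S :: "'a posg" (structure)
  assumes add_comm_monoid:
      "comm_monoid \<lparr>carrier = carrier S, mult = add S, one = zero S\<rparr>"
    and leq_refl: "reflp_on (carrier S) (leq S)"
    and leq_antisym: "antisymp_on (carrier S) (leq S)"
    and leq_trans: "transp_on (carrier S) (leq S)"
    and add_mono: "\<lbrakk>a \<in> carrier S; b \<in> carrier S; c \<in> carrier S; a \<preceq> b\<rbrakk>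
                     \<Longrightarrow> a \<oplus> c \<preceq> b \<oplus> c"
    and zero_least: "a \<in> carrier S \<Longrightarrow> \<zero> \<preceq> a"

definition is_sup :: "'a posg \<Rightarrow> 'a set \<Rightarrow> 'a \<Rightarrow> bool" where
  "is_sup S A s \<longleftrightarrow> s \<in> carrier S \<and> (\<forall>x\<in>A. x \<preceq>\<^bsub>S\<^esub> s) \<and>
     (\<forall>u\<in>carrier S. (\<forall>x\<in>A. x \<preceq>\<^bsub>S\<^esub> u) \<longrightarrow> s \<preceq>\<^bsub>S\<^esub> u)"

definition increasing :: "'a posg \<Rightarrow> (nat \<Rightarrow> 'a) \<Rightarrow> bool" where
  "increasing S c \<longleftrightarrow> (\<forall>n. c n \<in> carrier S \<and> c n \<preceq>\<^bsub>S\<^esub> c (Suc n))"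

definition way_below :: "'a posg \<Rightarrow> 'a \<Rightarrow> 'a \<Rightarrow> bool" where
  "way_below S a b \<longleftrightarrow> a \<in> carrier S \<and> b \<in> carrier S \<and>
     (\<forall>c s. increasing S c \<and> is_sup S (range c) s \<and> b \<preceq>\<^bsub>S\<^esub> s \<longrightarrow> (\<exists>k. a \<preceq>\<^bsub>S\<^esub> c k))"

locale cu_semigroup = pos_ordered_semigroup +
  assumes O1: "increasing S c \<Longrightarrow> \<exists>s. is_sup S (range c) s"
    and O2: "a \<in> carrier S \<Longrightarrow> \<exists>c. (\<forall>n. way_below S (c n) (c (Suc n))) \<and> is_sup S (range c) a"
    and O3: "\<lbrakk>way_below S a' a; way_below S b' b\<rbrakk> \<Longrightarrow> way_below S (a' \<oplus> b') (a \<oplus> b)"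
    and O4: "\<lbrakk>increasing S c; increasing S d; is_sup S (range c) s; is_sup S (range d) t\<rbrakk>
               \<Longrightarrow> is_sup S (range (\<lambda>n. c n \<oplus> d n)) (s \<oplus> t)"

section \<open>Morphisms and bimorphisms\<close>

text \<open>
  As for \<open>hom\<close> in HOL-Algebra, morphisms are functions on the whole type of which only the
  restriction to the carrier matters; uniqueness of a morphism always means uniqueness on the
  carrier.
\<close>

definition gen_cu_hom :: "'a posg \<Rightarrow> 'b posg \<Rightarrow> ('a \<Rightarrow> 'b) set" where
  "gen_cu_hom S T = {f. f \<in> carrier S \<rightarrow> carrier T \<and>
     (\<forall>a\<in>carrier S. \<forall>b\<in>carrier S. f (a \<oplus>\<^bsub>S\<^esub> b) = f a \<oplus>\<^bsub>T\<^esub> f b) \<and>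
     f \<zero>\<^bsub>S\<^esub> = \<zero>\<^bsub>T\<^esub> \<and>
     (\<forall>a\<in>carrier S. \<forall>b\<in>carrier S. a \<preceq>\<^bsub>S\<^esub> b \<longrightarrow> f a \<preceq>\<^bsub>T\<^esub> f b) \<and>
     (\<forall>c s. increasing S c \<and> is_sup S (range c) s \<longrightarrow> is_sup T (range (\<lambda>n. f (c n))) (f s))}"

definition cu_hom :: "'a posg \<Rightarrow> 'b posg \<Rightarrow> ('a \<Rightarrow> 'b) set" where
  "cu_hom S T = {f \<in> gen_cu_hom S T.
     \<forall>a' a. way_below S a' a \<longrightarrow> way_below T (f a') (f a)}"

definition cu_bimorphism :: "'a posg \<Rightarrow> 'b posg \<Rightarrow> 'c posg \<Rightarrow> ('a \<Rightarrow> 'b \<Rightarrow> 'c) \<Rightarrow> bool" where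
  "cu_bimorphism S T P \<phi> \<longleftrightarrow>
     (\<forall>a\<in>carrier S. \<forall>b\<in>carrier T. \<phi> a b \<in> carrier P) \<and>
     (\<forall>a\<in>carrier S. \<forall>a'\<in>carrier S. \<forall>b\<in>carrier T.
        \<phi> (a \<oplus>\<^bsub>S\<^esub> a') b = \<phi> a b \<oplus>\<^bsub>P\<^esub> \<phi> a' b \<and> (a \<preceq>\<^bsub>S\<^esub> a' \<longrightarrow> \<phi> a b \<preceq>\<^bsub>P\<^esub> \<phi> a' b)) \<and>
     (\<forall>a\<in>carrier S. \<forall>b\<in>carrier T. \<forall>b'\<in>carrier T.
        \<phi> a (b \<oplus>\<^bsub>T\<^esub> b') = \<phi> a b \<oplus>\<^bsub>P\<^esub> \<phi> a b' \<and> (b \<preceq>\<^bsub>T\<^esub> b' \<longrightarrow> \<phi> a b \<preceq>\<^bsub>P\<^esub> \<phi> a b')) \<and>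
     (\<forall>b\<in>carrier T. \<phi> \<zero>\<^bsub>S\<^esub> b = \<zero>\<^bsub>P\<^esub>) \<and> (\<forall>a\<in>carrier S. \<phi> a \<zero>\<^bsub>T\<^esub> = \<zero>\<^bsub>P\<^esub>) \<and>
     (\<forall>c d s t. increasing S c \<and> increasing T d \<and> is_sup S (range c) s \<and> is_sup T (range d) t
        \<longrightarrow> is_sup P (range (\<lambda>n. \<phi> (c n) (d n))) (\<phi> s t)) \<and>
     (\<forall>a' a b' b. way_below S a' a \<and> way_below T b' b \<longrightarrow> way_below P (\<phi> a' b') (\<phi> a b))"

section \<open>Tensor products\<close>

text \<open>
  \<open>is_tensor_product TYPE('q) S T X t\<close>: the Cu-semigroup \<open>X\<close> with the map \<open>t a b\<close>, written
  \<open>a \<otimes> b\<close> on paper, has the universal property of \<open>S \<otimes> T\<close>. HOL cannot quantify over types inside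
  a formula, so the test objects range over all Cu-semigroups whose carrier lies in the type \<open>'q\<close>.
  A tensor product in the unrestricted sense satisfies this predicate for every \<open>'q\<close>, so a theorem
  that assumes it for some particular \<open>'q\<close> applies to every genuine tensor product.
\<close>

definition is_tensor_product ::
    "'q itself \<Rightarrow> 'a posg \<Rightarrow> 'b posg \<Rightarrow> 'x posg \<Rightarrow> ('a \<Rightarrow> 'b \<Rightarrow> 'x) \<Rightarrow> bool" where
  "is_tensor_product _ S T X t \<longleftrightarrow>
     cu_semigroup X \<and> cu_bimorphism S T X t \<and>
     (\<forall>Q :: 'q posg. cu_semigroup Q \<longrightarrow>
        (\<forall>\<phi>. cu_bimorphism S T Q \<phi> \<longrightarrow>
           (\<exists>h\<in>cu_hom X Q. (\<forall>a\<in>carrier S. \<forall>b\<in>carrier T. h (t a b) = \<phi> a b) \<and>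
              (\<forall>h'\<in>cu_hom X Q. (\<forall>a\<in>carrier S. \<forall>b\<in>carrier T. h' (t a b) = \<phi> a b) \<longrightarrow>
                 (\<forall>z\<in>carrier X. h' z = h z)))) \<and>
        (\<forall>\<alpha>1\<in>cu_hom X Q. \<forall>\<alpha>2\<in>cu_hom X Q.
           (\<forall>z\<in>carrier X. \<alpha>1 z \<preceq>\<^bsub>Q\<^esub> \<alpha>2 z) \<longleftrightarrow>
           (\<forall>a\<in>carrier S. \<forall>b\<in>carrier T. \<alpha>1 (t a b) \<preceq>\<^bsub>Q\<^esub> \<alpha>2 (t a b))))"

text \<open>\<open>h\<close> is \<open>\<phi>1 \<otimes> \<phi>2\<close>, from \<open>S1 \<otimes> S2 = (X, t)\<close> to \<open>T1 \<otimes> T2 = (Y, u)\<close>.\<close>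

definition is_tensor_map ::
    "'a posg \<Rightarrow> 'b posg \<Rightarrow> 'x posg \<Rightarrow> ('a \<Rightarrow> 'b \<Rightarrow> 'x) \<Rightarrow> 'y posg \<Rightarrow> ('c \<Rightarrow> 'd \<Rightarrow> 'y) \<Rightarrow>
     ('a \<Rightarrow> 'c) \<Rightarrow> ('b \<Rightarrow> 'd) \<Rightarrow> ('x \<Rightarrow> 'y) \<Rightarrow> bool" where
  "is_tensor_map S1 S2 X t Y u \<phi>1 \<phi>2 h \<longleftrightarrow> h \<in> cu_hom X Y \<and>
     (\<forall>a\<in>carrier S1. \<forall>b\<in>carrier S2. h (t a b) = u (\<phi>1 a) (\<phi>2 b))"

text \<open>
  \<open>h\<close> is the associativity isomorphism from \<open>(A \<otimes> B) \<otimes> C\<close> to \<open>A \<otimes> (B \<otimes> C)\<close>, where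
  \<open>A \<otimes> B\<close>, \<open>(A \<otimes> B) \<otimes> C\<close>, \<open>B \<otimes> C\<close>, \<open>A \<otimes> (B \<otimes> C)\<close> are given by \<open>AB, t_AB\<close>, \<open>L, t_L\<close>,
  \<open>BC, t_BC\<close> and \<open>R, t_R\<close> (the carriers \<open>AB\<close> and \<open>BC\<close> are not needed here).
\<close>

definition is_associator ::
    "'a posg \<Rightarrow> 'b posg \<Rightarrow> 'c posg \<Rightarrow> ('a \<Rightarrow> 'b \<Rightarrow> 'ab) \<Rightarrow> 'l posg \<Rightarrow> ('ab \<Rightarrow> 'c \<Rightarrow> 'l) \<Rightarrow>
     ('b \<Rightarrow> 'c \<Rightarrow> 'bc) \<Rightarrow> 'r posg \<Rightarrow> ('a \<Rightarrow> 'bc \<Rightarrow> 'r) \<Rightarrow> ('l \<Rightarrow> 'r) \<Rightarrow> bool" where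
  "is_associator A B C t_AB L t_L t_BC R t_R h \<longleftrightarrow>
     h \<in> cu_hom L R \<and> bij_betw h (carrier L) (carrier R) \<and>
     inv_into (carrier L) h \<in> cu_hom R L \<and>
     (\<forall>a\<in>carrier A. \<forall>b\<in>carrier B. \<forall>c\<in>carrier C.
        h (t_L (t_AB a b) c) = t_R a (t_BC b c))"

section \<open>Paths and the internal hom\<close>

definition I_Q :: "rat set" where
  "I_Q = {0<..<1}"

definition prec :: "'a posg \<Rightarrow> 'b posg \<Rightarrow> ('a \<Rightarrow> 'b) \<Rightarrow> ('a \<Rightarrow> 'b) \<Rightarrow> bool" where
  "prec S T \<phi> \<psi> \<longleftrightarrow> (\<forall>a' a. way_below S a' a \<longrightarrow> way_below T (\<phi> a') (\<psi> a))"

text \<open>As with morphisms, the values of a path at indices outside \<open>I_Q\<close> are irrelevant.\<close>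

definition paths :: "'a posg \<Rightarrow> 'b posg \<Rightarrow> (rat \<Rightarrow> 'a \<Rightarrow> 'b) set" where
  "paths S T = {f. (\<forall>l\<in>I_Q. f l \<in> gen_cu_hom S T) \<and>
     (\<forall>l'\<in>I_Q. \<forall>l\<in>I_Q. l' < l \<longrightarrow> prec S T (f l') (f l))}"

definition path_le :: "'a posg \<Rightarrow> 'b posg \<Rightarrow> (rat \<Rightarrow> 'a \<Rightarrow> 'b) \<Rightarrow> (rat \<Rightarrow> 'a \<Rightarrow> 'b) \<Rightarrow> bool" where
  "path_le S T f g \<longleftrightarrow> (\<forall>l\<in>I_Q. \<exists>m\<in>I_Q. prec S T (f l) (g m))"

definition path_rel :: "'a posg \<Rightarrow> 'b posg \<Rightarrow> ((rat \<Rightarrow> 'a \<Rightarrow> 'b) \<times> (rat \<Rightarrow> 'a \<Rightarrow> 'b)) set" where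
  "path_rel S T = {(f, g). f \<in> paths S T \<and> g \<in> paths S T \<and> path_le S T f g \<and> path_le S T g f}"

definition path_class :: "'a posg \<Rightarrow> 'b posg \<Rightarrow> (rat \<Rightarrow> 'a \<Rightarrow> 'b) \<Rightarrow> (rat \<Rightarrow> 'a \<Rightarrow> 'b) set" where
  "path_class S T f = path_rel S T `` {f}"

definition ihom :: "'a posg \<Rightarrow> 'b posg \<Rightarrow> (rat \<Rightarrow> 'a \<Rightarrow> 'b) set posg" where
  "ihom S T =
     \<lparr>carrier = paths S T // path_rel S T,
      add = (\<lambda>x y. \<Union>f\<in>x. \<Union>g\<in>y. path_class S T (\<lambda>l a. f l a \<oplus>\<^bsub>T\<^esub> g l a)),
      zero = path_class S T (\<lambda>l a. \<zero>\<^bsub>T\<^esub>),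
      leq = (\<lambda>x y. \<exists>f\<in>x. \<exists>g\<in>y. path_le S T f g)\<rparr>"

text \<open>The endpoint map, read off from any representative \<open>f\<close> of the class \<open>x\<close>.\<close>

definition endpoint :: "'b posg \<Rightarrow> (rat \<Rightarrow> 'a \<Rightarrow> 'b) set \<Rightarrow> 'a \<Rightarrow> 'b" where
  "endpoint T x a = (THE s. \<exists>f\<in>x. is_sup T ((\<lambda>l. f l a) ` I_Q) s)"

section \<open>The adjunction, evaluation and composition\<close>

text \<open>
  \<open>adjoint_pair S T P X t \<alpha> h\<close>: with \<open>S \<otimes> T = (X, t)\<close>, the Cu-morphisms \<open>\<alpha>\<close> from \<open>S\<close> to
  \<open>ihom T P\<close> and \<open>h\<close> from \<open>X\<close> to \<open>P\<close> correspond to each other under the natural bijection.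
\<close>

definition adjoint_pair ::
    "'a posg \<Rightarrow> 'b posg \<Rightarrow> 'c posg \<Rightarrow> 'x posg \<Rightarrow> ('a \<Rightarrow> 'b \<Rightarrow> 'x) \<Rightarrow>
     ('a \<Rightarrow> (rat \<Rightarrow> 'b \<Rightarrow> 'c) set) \<Rightarrow> ('x \<Rightarrow> 'c) \<Rightarrow> bool" where
  "adjoint_pair S T P X t \<alpha> h \<longleftrightarrow> \<alpha> \<in> cu_hom S (ihom T P) \<and> h \<in> cu_hom X P \<and>
     (\<forall>a\<in>carrier S. \<forall>b\<in>carrier T. h (t a b) = endpoint P (\<alpha> a) b)"

text \<open>\<open>e\<close> is the evaluation map from \<open>ihom S T \<otimes> S = (X, t)\<close> to \<open>T\<close>.\<close>

definition is_evaluation ::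
    "'a posg \<Rightarrow> 'b posg \<Rightarrow> 'x posg \<Rightarrow> ((rat \<Rightarrow> 'a \<Rightarrow> 'b) set \<Rightarrow> 'a \<Rightarrow> 'x) \<Rightarrow> ('x \<Rightarrow> 'b) \<Rightarrow> bool" where
  "is_evaluation S T X t e \<longleftrightarrow> adjoint_pair (ihom S T) S T X t id e"

end

theory Submission
  imports Defs "HOL-Library.Nat_Bijection"
begin

text \<open>
  The endpoint map does not separate the elements of the internal hom, but it controls the
  way-below relation: if \<open>[k]\<close> is way below \<open>[h]\<close> then the endpoint of \<open>k\<close> lies below some \<open>h m\<close>, and if the
  endpoint of \<open>k\<close> lies below some \<open>h m\<close> then \<open>[k] \<le> [h]\<close>. Cut off \<open>f\<close> and \<open>g\<close> at indices
  \<open>q n\<close> increasing to 1. The classes of the truncations are way below \<open>[f]\<close> and \<open>[g]\<close>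
  and have these as suprema, so \<open>[g] \<circ> [f]\<close> is the supremum of the composition products of the
  truncations, each of which is way below it. The adjunction identifies the endpoint of such a
  product with the composite of the two endpoints, which lies between \<open>g l \<circ> f l\<close> for every
  \<open>l < q n\<close> and \<open>g (q n) \<circ> f (q n)\<close>. This gives both inequalities.
\<close>

section \<open>Order and the way-below relation\<close>

lemma way_below_closed:
  assumes "way_below S a b"
  shows "a \<in> carrier S" "b \<in> carrier S"
  using assms by (simp_all add: way_below_def)

context pos_ordered_semigroup
begin

lemma le_refl: "a \<in> carrier S \<Longrightarrow> a \<preceq> a"
  using leq_refl by (simp add: reflp_on_def)

lemma le_antisym: "\<lbrakk>a \<preceq> b; b \<preceq> a; a \<in> carrier S; b \<in> carrier S\<rbrakk> \<Longrightarrow> a = b"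
  using leq_antisym by (simp add: antisymp_on_def)

lemma le_trans:
  "\<lbrakk>a \<preceq> b; b \<preceq> c; a \<in> carrier S; b \<in> carrier S; c \<in> carrier S\<rbrakk> \<Longrightarrow> a \<preceq> c"
  using leq_trans unfolding transp_on_def by blast

lemma way_below_imp_le:
  assumes "way_below S a b"
  shows "a \<preceq> b"
proof -
  have b: "b \<in> carrier S"
    using assms by (simp add: way_below_def)
  \<comment> \<open>The definition of \<open>way_below\<close> is tested on the constant sequence at
    \<open>b\<close>.\<close>
  have "increasing S (\<lambda>_. b)" "is_sup S (range (\<lambda>_::nat. b)) b"
    using b by (auto simp: increasing_def is_sup_def le_refl)
  then show ?thesis
    using assms b le_refl unfolding way_below_def by blast
qed

lemma way_below_le_trans:
  assumes "way_below S a b" "b \<preceq> c" "c \<in> carrier S"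
  shows "way_below S a c"
proof -
  have "\<exists>k. a \<preceq> d k" if "increasing S d" "is_sup S (range d) s" "c \<preceq> s" for d s
  proof -
    have "b \<preceq> s"
      using that assms le_trans unfolding way_below_def is_sup_def by blast
    then show ?thesis
      using assms(1) that unfolding way_below_def by blast
  qed
  then show ?thesis
    using assms unfolding way_below_def by blast
qed

end

text \<open>\<open>O2\<close> only makes each term way below its successor. The successor lies below
  the supremum \<open>a\<close>, so each term is way below \<open>a\<close> itself.\<close>

lemma (in cu_semigroup) way_below_approx:
  assumes "a \<in> carrier S"
  obtains c where "increasing S c" "is_sup S (range c) a" "\<forall>n. way_below S (c n) a"
proof -
  obtain c where "(\<forall>n. way_below S (c n) (c (Suc n))) \<and> is_sup S (range c) a"
    using O2[OF assms] by (rule exE)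
  then have c: "\<And>n. way_below S (c n) (c (Suc n))" "is_sup S (range c) a"
    by simp_all
  have "increasing S c"
    unfolding increasing_def
    using way_below_imp_le[OF c(1)] way_below_closed(1)[OF c(1)] by blast
  moreover have "way_below S (c n) a" for n
    using c(2) way_below_le_trans[OF c(1)] assms unfolding is_sup_def by blast
  ultimately show ?thesis
    using c(2) that by blast
qed

section \<open>Generalized Cu-morphisms\<close>

lemma gen_cu_hom_closed: "\<lbrakk>f \<in> gen_cu_hom S T; a \<in> carrier S\<rbrakk> \<Longrightarrow> f a \<in> carrier T"
  by (auto simp: gen_cu_hom_def)

lemma gen_cu_hom_mono:
  "\<lbrakk>f \<in> gen_cu_hom S T; a \<preceq>\<^bsub>S\<^esub> b; a \<in> carrier S; b \<in> carrier S\<rbrakk> \<Longrightarrow> f a \<preceq>\<^bsub>T\<^esub> f b"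
  by (auto simp: gen_cu_hom_def)

lemma gen_cu_hom_sup:
  "\<lbrakk>f \<in> gen_cu_hom S T; increasing S c; is_sup S (range c) s\<rbrakk>
    \<Longrightarrow> is_sup T (range (\<lambda>n. f (c n))) (f s)"
  by (auto simp: gen_cu_hom_def)

lemma gen_cu_hom_increasing:
  "\<lbrakk>f \<in> gen_cu_hom S T; increasing S c\<rbrakk> \<Longrightarrow> increasing T (\<lambda>n. f (c n))"
  by (simp add: increasing_def gen_cu_hom_closed gen_cu_hom_mono)

lemma gen_cu_hom_comp:
  assumes "f \<in> gen_cu_hom S T" "g \<in> gen_cu_hom T P"
  shows "g \<circ> f \<in> gen_cu_hom S P"
proof -
  have "is_sup P (range (\<lambda>n. g (f (c n)))) (g (f s))"
    if "increasing S c" "is_sup S (range c) s" for c s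
    using gen_cu_hom_sup[OF assms(2) gen_cu_hom_increasing[OF assms(1) that(1)]
        gen_cu_hom_sup[OF assms(1) that]] .
  then show ?thesis
    using assms unfolding gen_cu_hom_def by (auto simp: Pi_iff)
qed

section \<open>Paths\<close>

lemma I_Q_pos: "a \<in> I_Q \<Longrightarrow> 0 < a"
  by (simp add: I_Q_def)

lemma I_Q_mult: "\<lbrakk>a \<in> I_Q; b \<in> I_Q\<rbrakk> \<Longrightarrow> a * b \<in> I_Q"
  using mult_strict_mono[of a 1 b 1] by (simp add: I_Q_def)

lemma I_Q_midpoint: "a \<in> I_Q \<Longrightarrow> (a + 1) / 2 \<in> I_Q"
  by (simp add: I_Q_def)

text \<open>This sequence, later called \<open>q\<close>, is cofinal in \<open>I_Q\<close> and turns
  suprema over \<open>I_Q\<close> into suprema of sequences. It starts at 1/2, so that the index 0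
  causes no exception.\<close>

lemma I_Q_seq: "rat_of_nat (Suc n) / rat_of_nat (n + 2) \<in> I_Q"
  by (simp add: I_Q_def)

lemma I_Q_seq_mono:
  "m < n \<Longrightarrow> rat_of_nat (Suc m) / rat_of_nat (m + 2) < rat_of_nat (Suc n) / rat_of_nat (n + 2)"
  by (simp add: field_simps)

lemma I_Q_seq_cofinal:
  assumes "l \<in> I_Q"
  obtains n where "l < rat_of_nat (Suc n) / rat_of_nat (n + 2)"
proof -
  obtain n where n: "1 / (1 - l) < rat_of_nat n"
    using reals_Archimedean2 by blast
  have "l < rat_of_nat (Suc n) / rat_of_nat (n + 2)"
    using n assms by (simp add: I_Q_def field_simps)
  then show ?thesis ..
qed

lemma paths_gen_cu_hom: "\<lbrakk>f \<in> paths S T; l \<in> I_Q\<rbrakk> \<Longrightarrow> f l \<in> gen_cu_hom S T"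
  by (simp add: paths_def)

lemma paths_prec: "\<lbrakk>f \<in> paths S T; k < l; k \<in> I_Q; l \<in> I_Q\<rbrakk> \<Longrightarrow> prec S T (f k) (f l)"
  by (simp add: paths_def)

lemma paths_closed: "\<lbrakk>f \<in> paths S T; l \<in> I_Q; a \<in> carrier S\<rbrakk> \<Longrightarrow> f l a \<in> carrier T"
  by (rule gen_cu_hom_closed[OF paths_gen_cu_hom])

lemma paths_comp:
  assumes "f \<in> paths S T" "g \<in> paths T P"
  shows "(\<lambda>l. g l \<circ> f l) \<in> paths S P"
  using assms by (auto simp: paths_def prec_def intro!: gen_cu_hom_comp)

text \<open>The part of a path below index \<open>m\<close>, stretched linearly so that it is again
  indexed by all of \<open>I_Q\<close>.\<close>

definition trunc :: "rat \<Rightarrow> (rat \<Rightarrow> 'a \<Rightarrow> 'b) \<Rightarrow> rat \<Rightarrow> 'a \<Rightarrow> 'b" where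
  "trunc m f l = f (m * l)"

lemma trunc_paths: "\<lbrakk>f \<in> paths S T; m \<in> I_Q\<rbrakk> \<Longrightarrow> trunc m f \<in> paths S T"
  using I_Q_pos[of m] by (auto simp: paths_def trunc_def I_Q_mult)

lemma trunc_index: "m \<in> I_Q \<Longrightarrow> l \<in> I_Q \<Longrightarrow> l < m \<Longrightarrow> l / m \<in> I_Q \<and> trunc m f (l / m) = f l"
  by (simp add: I_Q_def trunc_def)

lemma mult_I_Q_less: "m \<in> I_Q \<Longrightarrow> l \<in> I_Q \<Longrightarrow> m * l < m"
  by (simp add: I_Q_def)

section \<open>Comparison of morphisms and of paths\<close>

locale cu_semigroup_pair = S: cu_semigroup S + T: cu_semigroup T
  for S :: "'a posg" and T :: "'b posg"
begin

text \<open>Approximate \<open>a\<close> by a sequence of elements way below it: \<open>prec\<close>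
  bounds the values of \<open>\<phi>\<close> on the sequence by \<open>\<psi> a\<close>, and
  \<open>\<phi>\<close> preserves the supremum.\<close>

lemma prec_le:
  assumes "prec S T \<phi> \<psi>" "\<phi> \<in> gen_cu_hom S T" "\<psi> \<in> gen_cu_hom S T" "a \<in> carrier S"
  shows "\<phi> a \<preceq>\<^bsub>T\<^esub> \<psi> a"
proof -
  obtain c where c: "increasing S c" "is_sup S (range c) a" "\<forall>n. way_below S (c n) a"
    using S.way_below_approx[OF assms(4)] by blast
  have "\<phi> (c n) \<preceq>\<^bsub>T\<^esub> \<psi> a" for n
    using assms(1) c(3) T.way_below_imp_le by (auto simp: prec_def)
  then show ?thesis
    using gen_cu_hom_sup[OF assms(2) c(1,2)] gen_cu_hom_closed[OF assms(3,4)]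
    by (auto simp: is_sup_def)
qed

lemma prec_le_trans:
  assumes "prec S T \<phi> \<psi>" "\<And>a. a \<in> carrier S \<Longrightarrow> \<psi> a \<preceq>\<^bsub>T\<^esub> \<chi> a" "\<chi> \<in> gen_cu_hom S T"
  shows "prec S T \<phi> \<chi>"
  unfolding prec_def
proof (intro allI impI)
  fix a' a assume "way_below S a' a"
  then show "way_below T (\<phi> a') (\<chi> a)"
    using assms T.way_below_le_trans[of "\<phi> a'" "\<psi> a" "\<chi> a"]
    by (auto simp: prec_def way_below_def[of S] gen_cu_hom_closed)
qed

lemma prec_trans:
  assumes "prec S T \<phi> \<psi>" "prec S T \<psi> \<chi>" "\<psi> \<in> gen_cu_hom S T" "\<chi> \<in> gen_cu_hom S T"
  shows "prec S T \<phi> \<chi>"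
  by (rule prec_le_trans[OF assms(1) prec_le[OF assms(2-4)] assms(4)])

lemma paths_le:
  assumes "f \<in> paths S T" "k \<in> I_Q" "l \<in> I_Q" "k \<le> l" "a \<in> carrier S"
  shows "f k a \<preceq>\<^bsub>T\<^esub> f l a"
proof (cases "k = l")
  case True
  then show ?thesis
    using T.le_refl[OF paths_closed[OF assms(1,3,5)]] by simp
next
  case False
  then show ?thesis
    using prec_le[OF paths_prec[OF assms(1) _ assms(2,3)] paths_gen_cu_hom[OF assms(1,2)]
        paths_gen_cu_hom[OF assms(1,3)] assms(5)] assms(4) by simp
qed

lemma prec_paths_le:
  assumes "prec S T \<phi> (f k)" "f \<in> paths S T" "k \<in> I_Q" "l \<in> I_Q" "k \<le> l"
  shows "prec S T \<phi> (f l)"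
  by (rule prec_le_trans[OF assms(1) paths_le[OF assms(2-5)] paths_gen_cu_hom[OF assms(2,4)]])

lemma path_le_refl: "f \<in> paths S T \<Longrightarrow> path_le S T f f"
  unfolding path_le_def
proof
  fix l assume f: "f \<in> paths S T" and l: "l \<in> I_Q"
  \<comment> \<open>\<open>prec\<close> need not be reflexive, so a strictly larger index is
    taken.\<close>
  have "l < (l + 1) / 2"
    using l by (simp add: I_Q_def)
  then show "\<exists>m\<in>I_Q. prec S T (f l) (f m)"
    using f l I_Q_midpoint paths_prec by blast
qed

lemma path_le_trans:
  assumes "path_le S T f g" "path_le S T g h" "g \<in> paths S T" "h \<in> paths S T"
  shows "path_le S T f h"
  unfolding path_le_def
proof
  fix l assume "l \<in> I_Q"
  then obtain m where m: "m \<in> I_Q" "prec S T (f l) (g m)"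
    using assms(1) by (auto simp: path_le_def)
  then obtain n where n: "n \<in> I_Q" "prec S T (g m) (h n)"
    using assms(2) by (auto simp: path_le_def)
  have "prec S T (f l) (h n)"
    by (rule prec_trans[OF m(2) n(2) paths_gen_cu_hom[OF assms(3) m(1)]
          paths_gen_cu_hom[OF assms(4) n(1)]])
  then show "\<exists>n\<in>I_Q. prec S T (f l) (h n)"
    using n(1) by blast
qed

section \<open>The quotient by equivalence of paths\<close>

lemma equiv_path_rel: "equiv (paths S T) (path_rel S T)"
proof (rule equivI)
  show "refl_on (paths S T) (path_rel S T)"
    using path_le_refl by (auto simp: refl_on_def path_rel_def)
  show "sym (path_rel S T)"
    by (auto simp: sym_def path_rel_def)
  show "trans (path_rel S T)"
    using path_le_trans unfolding trans_def path_rel_def by blast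
qed (auto simp: path_rel_def)

lemma path_class_eq:
  assumes "f \<in> paths S T" "g \<in> paths S T" "path_le S T f g" "path_le S T g f"
  shows "path_class S T f = path_class S T g"
  unfolding path_class_def
  using assms by (intro equiv_class_eq[OF equiv_path_rel]) (simp add: path_rel_def)

lemma path_class_self: "f \<in> paths S T \<Longrightarrow> f \<in> path_class S T f"
  unfolding path_class_def by (rule equiv_class_self[OF equiv_path_rel])

lemma path_class_closed: "f \<in> paths S T \<Longrightarrow> path_class S T f \<in> carrier (ihom S T)"
  by (simp add: ihom_def path_class_def quotientI)

lemma ihom_cases:
  assumes "x \<in> carrier (ihom S T)"
  obtains f where "f \<in> paths S T" "x = path_class S T f"
  using assms by (auto simp: ihom_def path_class_def elim: quotientE)

text \<open>The order of \<open>ihom\<close> asks for some pair of comparable representatives;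
  transitivity carries the comparison over to any other pair.\<close>

lemma path_class_leq_iff:
  assumes "f \<in> paths S T" "g \<in> paths S T"
  shows "path_class S T f \<preceq>\<^bsub>ihom S T\<^esub> path_class S T g \<longleftrightarrow> path_le S T f g"
proof
  assume "path_class S T f \<preceq>\<^bsub>ihom S T\<^esub> path_class S T g"
  then obtain f' g' where "(f, f') \<in> path_rel S T" "(g, g') \<in> path_rel S T" "path_le S T f' g'"
    by (auto simp: ihom_def path_class_def)
  then show "path_le S T f g"
    using path_le_trans unfolding path_rel_def by blast
next
  assume "path_le S T f g"
  then show "path_class S T f \<preceq>\<^bsub>ihom S T\<^esub> path_class S T g"
    using assms path_class_self by (auto simp: ihom_def)
qed

section \<open>Suprema and way-below in the internal hom\<close>

text \<open>
  The supremum runs through the \<open>n\<close>-th path while \<open>l / (1 - l)\<close> runs through \<open>[n, n + 1)\<close>. The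
  starting point \<open>m n\<close> in that path is chosen beyond the previous segment and beyond one of the
  countably many \<open>f i ((j + 1) / (j + 2))\<close> with \<open>i \<le> n\<close>, so that every one of them is eventually passed.
\<close>

lemma path_sequence_sup:
  fixes f :: "nat \<Rightarrow> rat \<Rightarrow> 'a \<Rightarrow> 'b"
  assumes f: "\<And>n. f n \<in> paths S T" and le: "\<And>n. path_le S T (f n) (f (Suc n))"
  obtains h where "h \<in> paths S T" "\<forall>n. path_le S T (f n) h"
    "\<forall>l. \<exists>n. \<exists>k\<in>I_Q. h l = f n k"
proof -
  define q :: "nat \<Rightarrow> rat" where "q n = rat_of_nat (Suc n) / rat_of_nat (n + 2)" for n
  have q: "q n \<in> I_Q" for n
    unfolding q_def by (rule I_Q_seq)
  \<comment> \<open>\<open>prod_decode\<close> enumerates all pairs \<open>(i, j)\<close>, so each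
    \<open>f i (q j)\<close> is the task of exactly one \<open>n\<close>.\<close>
  define task :: "nat \<Rightarrow> 'a \<Rightarrow> 'b" where "task n = (case prod_decode n of (i, j) \<Rightarrow> f i (q j))" for n
  have f_hom: "f n l \<in> gen_cu_hom S T" if "l \<in> I_Q" for n :: nat and l
    using f paths_gen_cu_hom that by blast
  have le_add: "path_le S T (f n) (f (n + d))" for n d :: nat
  proof (induction d)
    case 0
    then show ?case
      using f path_le_refl by simp
  next
    case (Suc d)
    then show ?case
      using f le path_le_trans by auto
  qed
  have task: "\<exists>m\<in>I_Q. prec S T (task n) (f n m)" for n :: nat
  proof -
    obtain i j where ij: "prod_decode n = (i, j)"
      by fastforce
    \<comment> \<open>The pairing function dominates its first argument, so path \<open>i\<close>
      precedes path \<open>n\<close> and the task can be met inside path \<open>n\<close>.\<close>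
    then have "i \<le> n"
      using le_prod_encode_1[of i j] prod_decode_inverse[of n] by simp
    then show ?thesis
      using le_add[of i "n - i"] q ij by (auto simp: path_le_def task_def)
  qed
  \<comment> \<open>The segment used in path \<open>n\<close> starts at \<open>m n\<close> and stops
    short of the midpoint \<open>(m n + 1) / 2\<close>. The next segment has to start beyond that
    midpoint in the sense of \<open>prec\<close>.\<close>
  have "\<exists>m. \<forall>n. (m n \<in> I_Q \<and> prec S T (task n) (f n (m n))) \<and>
      prec S T (f n ((m n + 1) / 2)) (f (Suc n) (m (Suc n)))"
  proof (rule dependent_nat_choice)
    show "\<exists>m. m \<in> I_Q \<and> prec S T (task 0) (f 0 m)"
      using task by blast
  next
    fix m :: rat and n :: nat
    assume m: "m \<in> I_Q \<and> prec S T (task n) (f n m)"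
    obtain k1 where k1: "k1 \<in> I_Q" "prec S T (task (Suc n)) (f (Suc n) k1)"
      using task by blast
    obtain k2 where k2: "k2 \<in> I_Q" "prec S T (f n ((m + 1) / 2)) (f (Suc n) k2)"
      using le[of n] m I_Q_midpoint by (auto simp: path_le_def)
    have "max k1 k2 \<in> I_Q"
      using k1 k2 by (simp add: max_def)
    then show "\<exists>m'. (m' \<in> I_Q \<and> prec S T (task (Suc n)) (f (Suc n) m')) \<and>
        prec S T (f n ((m + 1) / 2)) (f (Suc n) m')"
      using prec_paths_le[OF k1(2) f k1(1)] prec_paths_le[OF k2(2) f k2(1)]
        max.cobounded1 max.cobounded2 by blast
  qed
  then obtain m where m: "\<And>n. m n \<in> I_Q" "\<And>n. prec S T (task n) (f n (m n))"
    "\<And>n. prec S T (f n ((m n + 1) / 2)) (f (Suc n) (m (Suc n)))"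
    by metis
  have m_less: "m n < (m n + 1) / 2" for n
    using m(1)[of n] by (simp add: I_Q_def)
  \<comment> \<open>Each later segment is crossed from its start to its midpoint, and
    \<open>m(3)\<close> passes on to the next path.\<close>
  have segments: "prec S T (f n ((m n + 1) / 2)) (f (Suc (n + d)) (m (Suc (n + d))))" for n d :: nat
  proof (induction d)
    case 0
    then show ?case
      using m(3) by simp
  next
    case (Suc d)
    have "prec S T (f (Suc (n + d)) (m (Suc (n + d)))) (f (Suc (n + d)) ((m (Suc (n + d)) + 1) / 2))"
      using paths_prec[OF f m_less m(1) I_Q_midpoint[OF m(1)]] .
    then have "prec S T (f (Suc (n + d)) (m (Suc (n + d)))) (f (Suc (n + Suc d)) (m (Suc (n + Suc d))))"
      using prec_trans[OF _ m(3) f_hom f_hom] m(1) I_Q_midpoint by simp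
    then show ?case
      using prec_trans[OF Suc.IH _ f_hom f_hom] m(1) by blast
  qed
  \<comment> \<open>\<open>u\<close> maps \<open>I_Q\<close> increasingly into the positive
    rationals. The integer part of \<open>u l\<close> selects the path, and the fractional part
    gives the position within its segment.\<close>
  define u where "u l = l / (1 - l)" for l :: rat
  define N :: "rat \<Rightarrow> nat" where "N l = nat \<lfloor>u l\<rfloor>" for l
  define \<theta> :: "rat \<Rightarrow> rat" where "\<theta> l = m (N l) + (1 - m (N l)) / 2 * frac (u l)" for l
  define h :: "rat \<Rightarrow> 'a \<Rightarrow> 'b" where "h l = f (N l) (\<theta> l)" for l
  have u_pos: "0 < u l" if "l \<in> I_Q" for l
    using that by (simp add: u_def I_Q_def)
  have u_less: "u k < u l" if "k < l" "k \<in> I_Q" "l \<in> I_Q" for k l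
    using that by (simp add: u_def I_Q_def field_simps)
  have \<theta>: "m (N l) \<le> \<theta> l" "\<theta> l < (m (N l) + 1) / 2" "\<theta> l \<in> I_Q" for l
  proof -
    let ?m = "m (N l)"
    have pos: "0 < (1 - ?m) / 2"
      using m(1)[of "N l"] by (simp add: I_Q_def)
    have "(1 - ?m) / 2 * frac (u l) < (1 - ?m) / 2"
      using mult_strict_left_mono[OF frac_lt_1[of "u l"] pos] by simp
    moreover have "0 \<le> (1 - ?m) / 2 * frac (u l)"
      using pos by (simp add: mult_nonneg_nonneg frac_ge_0 less_imp_le del: times_divide_eq_left)
    ultimately show "?m \<le> \<theta> l" "\<theta> l < (?m + 1) / 2" "\<theta> l \<in> I_Q"
      using m(1)[of "N l"] unfolding \<theta>_def I_Q_def by (auto simp: field_simps)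
  qed
  have h_hom: "h l \<in> gen_cu_hom S T" for l
    unfolding h_def using f_hom \<theta>(3) by blast
  have h_prec: "prec S T (h k) (h l)" if "k < l" "k \<in> I_Q" "l \<in> I_Q" for k l
  proof (cases "N k = N l")
    case True
    \<comment> \<open>\<open>nat\<close> is injective only on nonnegative integers, hence the appeal
      to \<open>u_pos\<close>.\<close>
    have "\<lfloor>u k\<rfloor> = \<lfloor>u l\<rfloor>"
      using True u_pos[OF that(2)] u_pos[OF that(3)] by (simp add: N_def eq_nat_nat_iff)
    then have "frac (u k) < frac (u l)"
      using u_less[OF that] by (simp add: frac_def)
    moreover have "0 < (1 - m (N l)) / 2"
      using m(1)[of "N l"] by (simp add: I_Q_def)
    ultimately have "\<theta> k < \<theta> l"
      unfolding \<theta>_def True by (intro add_strict_left_mono mult_strict_left_mono)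
    then show ?thesis
      unfolding h_def True using paths_prec[OF f _ \<theta>(3) \<theta>(3)] by blast
  next
    case False
    have "N k \<le> N l"
      unfolding N_def using u_less[OF that] by (intro nat_mono floor_mono) simp
    with False obtain d where d: "N l = Suc (N k + d)"
      by (metis le_neq_implies_less less_imp_Suc_add)
    have "prec S T (h k) (f (N k) ((m (N k) + 1) / 2))"
      unfolding h_def using paths_prec[OF f \<theta>(2) \<theta>(3) I_Q_midpoint[OF m(1)]] .
    then have "prec S T (h k) (f (N l) (m (N l)))"
      unfolding d using prec_trans[OF _ segments f_hom f_hom] m(1) I_Q_midpoint by blast
    then show ?thesis
      unfolding h_def[of l] by (rule prec_paths_le[OF _ f m(1) \<theta>(3) \<theta>(1)])
  qed
  have h: "h \<in> paths S T"
    using h_hom h_prec by (simp add: paths_def)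
  have "path_le S T (f i) h" for i
    unfolding path_le_def
  proof
    fix k assume k: "k \<in> I_Q"
    obtain j where j: "k < q j"
      using I_Q_seq_cofinal[OF k] unfolding q_def by blast
    \<comment> \<open>With this \<open>n\<close> the task of path \<open>n\<close> is
      \<open>f i (q j)\<close>, which dominates \<open>f i k\<close>.\<close>
    define n where "n = prod_encode (i, j)"
    have "prec S T (f i k) (f i (q j))"
      using paths_prec[OF f j k q] .
    moreover have "prec S T (f i (q j)) (f n (m n))"
      using m(2)[of n] by (simp add: task_def n_def)
    ultimately have "prec S T (f i k) (f n (m n))"
      by (rule prec_trans[OF _ _ f_hom[OF q] f_hom[OF m(1)]])
    then have "prec S T (f i k) (f n ((m n + 1) / 2))"
      by (rule prec_paths_le[OF _ f m(1) I_Q_midpoint[OF m(1)] less_imp_le[OF m_less]])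
    then have "prec S T (f i k) (f (Suc n) (m (Suc n)))"
      by (rule prec_trans[OF _ m(3) f_hom[OF I_Q_midpoint[OF m(1)]] f_hom[OF m(1)]])
    \<comment> \<open>At \<open>q n\<close> the path \<open>h\<close> is just entering segment
      \<open>Suc n\<close>, which the previous step has placed beyond \<open>f i k\<close>.\<close>
    moreover have "u (q n) = rat_of_nat (Suc n)"
      by (simp add: u_def q_def field_simps)
    then have "N (q n) = Suc n"
      unfolding N_def by (metis floor_of_nat nat_int)
    ultimately have "prec S T (f i k) (h (q n))"
      using prec_paths_le[OF _ f m(1) \<theta>(3) \<theta>(1), where \<phi> = "f i k" and l1 = "q n"]
      by (simp add: h_def)
    then show "\<exists>l\<in>I_Q. prec S T (f i k) (h l)"
      using q by blast
  qed
  moreover have "\<exists>n. \<exists>k\<in>I_Q. h l = f n k" for l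
    unfolding h_def using \<theta>(3) by blast
  ultimately show ?thesis
    using that h by blast
qed

section \<open>Truncated paths\<close>

lemma trunc_prec:
  assumes "f \<in> paths S T" "m \<in> I_Q" "l \<in> I_Q"
  shows "prec S T (trunc m f l) (f m)"
  unfolding trunc_def using paths_prec[OF assms(1) mult_I_Q_less I_Q_mult] assms by blast

text \<open>The path \<open>h\<close> built from representatives of the sequence is an upper bound,
  so \<open>f\<close> lies below \<open>h\<close> and \<open>f m\<close> is \<open>prec\<close> some
  value of \<open>h\<close>. Every value of \<open>h\<close> is a value of one path
  \<open>p n\<close>, and that \<open>p n\<close> dominates the whole truncation.\<close>

lemma way_below_trunc:
  assumes f: "f \<in> paths S T" and m: "m \<in> I_Q"
  shows "way_below (ihom S T) (path_class S T (trunc m f)) (path_class S T f)"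
  unfolding way_below_def
proof (intro conjI allI impI)
  show "path_class S T (trunc m f) \<in> carrier (ihom S T)" "path_class S T f \<in> carrier (ihom S T)"
    using f m trunc_paths path_class_closed by blast+
  fix c s
  assume c: "increasing (ihom S T) c \<and> is_sup (ihom S T) (range c) s \<and>
    path_class S T f \<preceq>\<^bsub>ihom S T\<^esub> s"
  have "\<exists>p. p \<in> paths S T \<and> c n = path_class S T p" for n
    using c ihom_cases unfolding increasing_def by metis
  then obtain p where p: "\<And>n. p n \<in> paths S T" "\<And>n. c n = path_class S T (p n)"
    by metis
  have "path_le S T (p n) (p (Suc n))" for n
    using c p path_class_leq_iff unfolding increasing_def by metis
  then obtain h where h: "h \<in> paths S T" "\<forall>n. path_le S T (p n) h"
    "\<forall>l. \<exists>n. \<exists>k\<in>I_Q. h l = p n k"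
    using path_sequence_sup[of p] p by blast
  obtain r where r: "r \<in> paths S T" "s = path_class S T r"
    using c ihom_cases unfolding is_sup_def by metis
  have "s \<preceq>\<^bsub>ihom S T\<^esub> path_class S T h"
    using c h p path_class_closed path_class_leq_iff unfolding is_sup_def by auto
  then have "path_le S T f h"
    using c r h(1) f path_le_trans path_class_leq_iff by blast
  then obtain l where l: "l \<in> I_Q" "prec S T (f m) (h l)"
    using m by (auto simp: path_le_def)
  then obtain n k where n: "k \<in> I_Q" "prec S T (f m) (p n k)"
    using h(3) by metis
  have "path_le S T (trunc m f) (p n)"
    unfolding path_le_def using n(1) prec_trans[OF trunc_prec[OF f m] n(2)
        paths_gen_cu_hom[OF f m] paths_gen_cu_hom[OF p(1) n(1)]] by blast
  then show "\<exists>n. path_class S T (trunc m f) \<preceq>\<^bsub>ihom S T\<^esub> c n"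
    using p path_class_leq_iff trunc_paths[OF f m] by metis
qed

text \<open>All values of the shorter truncation are \<open>prec\<close> \<open>f m\<close>, which
  itself occurs as a value of the longer one.\<close>

lemma trunc_le_trunc:
  assumes f: "f \<in> paths S T" and m: "m \<in> I_Q" "m' \<in> I_Q" "m < m'"
  shows "path_le S T (trunc m f) (trunc m' f)"
  unfolding path_le_def using trunc_prec[OF f m(1)] trunc_index[OF m(2,1,3)] by metis

text \<open>Each \<open>f l\<close> with \<open>l < q n\<close> is a value of the
  \<open>n\<close>-th truncation, so a path dominating all truncations dominates
  \<open>f\<close>.\<close>

lemma trunc_sequence:
  assumes f: "f \<in> paths S T"
  defines "c \<equiv> \<lambda>n. path_class S T (trunc (rat_of_nat (Suc n) / rat_of_nat (n + 2)) f)"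
  shows "increasing (ihom S T) c" "is_sup (ihom S T) (range c) (path_class S T f)"
proof -
  define q :: "nat \<Rightarrow> rat" where "q n = rat_of_nat (Suc n) / rat_of_nat (n + 2)" for n
  have q: "q n \<in> I_Q" for n
    unfolding q_def by (rule I_Q_seq)
  have c: "c n = path_class S T (trunc (q n) f)" for n
    by (simp add: c_def q_def)
  have tr: "trunc (q n) f \<in> paths S T" for n
    using trunc_paths[OF f q] .
  have "q n < q (Suc n)" for n
    unfolding q_def by (rule I_Q_seq_mono) simp
  then show "increasing (ihom S T) c"
    unfolding increasing_def c using trunc_le_trunc[OF f q q] path_class_leq_iff[OF tr tr]
      path_class_closed[OF tr] by blast
  have "path_le S T (trunc (q n) f) f" for n
    unfolding path_le_def using trunc_prec[OF f q] q by blast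
  moreover have "path_le S T f g" if g: "g \<in> paths S T" and "\<And>n. path_le S T (trunc (q n) f) g" for g
    unfolding path_le_def
  proof
    fix l assume l: "l \<in> I_Q"
    obtain n where n: "l < q n"
      using I_Q_seq_cofinal[OF l] unfolding q_def by blast
    show "\<exists>k\<in>I_Q. prec S T (f l) (g k)"
      using that(2)[of n] trunc_index[OF q l n] unfolding path_le_def by metis
  qed
  ultimately show "is_sup (ihom S T) (range c) (path_class S T f)"
    unfolding is_sup_def c using path_class_leq_iff f tr path_class_closed
    by (auto elim!: ihom_cases)
qed

section \<open>The endpoint map\<close>

text \<open>\<open>O1\<close> only treats sequences, so the supremum is formed along the cofinal
  sequence \<open>q\<close>.\<close>

lemma path_value_sup:
  assumes f: "f \<in> paths S T" and a: "a \<in> carrier S"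
  shows "\<exists>s. is_sup T ((\<lambda>l. f l a) ` I_Q) s"
proof -
  define q :: "nat \<Rightarrow> rat" where "q n = rat_of_nat (Suc n) / rat_of_nat (n + 2)" for n
  have q: "q n \<in> I_Q" for n
    unfolding q_def by (rule I_Q_seq)
  have cl: "f l a \<in> carrier T" if "l \<in> I_Q" for l
    using paths_closed[OF f that a] .
  have "q n \<le> q (Suc n)" for n
    unfolding q_def by (rule less_imp_le, rule I_Q_seq_mono) simp
  then have "increasing T (\<lambda>n. f (q n) a)"
    using paths_le[OF f q q _ a] cl q by (simp add: increasing_def)
  then obtain s where s: "is_sup T (range (\<lambda>n. f (q n) a)) s"
    using T.O1 by blast
  have "f l a \<preceq>\<^bsub>T\<^esub> s" if l: "l \<in> I_Q" for l
  proof -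
    obtain n where "l < q n"
      using I_Q_seq_cofinal[OF l] unfolding q_def by blast
    then have "f l a \<preceq>\<^bsub>T\<^esub> f (q n) a"
      using paths_le[OF f l q _ a] by simp
    then show ?thesis
      using T.le_trans[of "f l a" "f (q n) a" s] s cl l q by (auto simp: is_sup_def)
  qed
  then have "is_sup T ((\<lambda>l. f l a) ` I_Q) s"
    using s q unfolding is_sup_def by auto
  then show ?thesis ..
qed

lemma path_le_values:
  assumes "path_le S T f g" "f \<in> paths S T" "g \<in> paths S T" "a \<in> carrier S" "l \<in> I_Q"
    and s: "is_sup T ((\<lambda>l. g l a) ` I_Q) s"
  shows "f l a \<preceq>\<^bsub>T\<^esub> s"
proof -
  obtain m where m: "m \<in> I_Q" "prec S T (f l) (g m)"
    using assms by (auto simp: path_le_def)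
  have "f l a \<preceq>\<^bsub>T\<^esub> g m a"
    by (rule prec_le[OF m(2) paths_gen_cu_hom[OF assms(2,5)] paths_gen_cu_hom[OF assms(3) m(1)] assms(4)])
  moreover have "g m a \<preceq>\<^bsub>T\<^esub> s" "s \<in> carrier T"
    using s m(1) by (auto simp: is_sup_def)
  moreover have "f l a \<in> carrier T" "g m a \<in> carrier T"
    using paths_closed[OF assms(2,5,4)] paths_closed[OF assms(3) m(1) assms(4)] .
  ultimately show ?thesis
    using T.le_trans by blast
qed

lemma endpoint_is_sup:
  assumes f: "f \<in> paths S T" and a: "a \<in> carrier S"
  shows "is_sup T ((\<lambda>l. f l a) ` I_Q) (endpoint T (path_class S T f) a)"
proof -
  obtain s where s: "is_sup T ((\<lambda>l. f l a) ` I_Q) s"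
    using path_value_sup[OF f a] by blast
  \<comment> \<open>This makes the description in \<open>endpoint\<close> independent of the
    representative: equivalent paths bound each other's suprema.\<close>
  have "t = s" if g: "g \<in> path_class S T f" and t: "is_sup T ((\<lambda>l. g l a) ` I_Q) t" for g t
  proof -
    have g': "g \<in> paths S T" "path_le S T f g" "path_le S T g f"
      using g by (auto simp: path_class_def path_rel_def)
    have "s \<preceq>\<^bsub>T\<^esub> t"
      using path_le_values[OF g'(2) f g'(1) a _ t] s t by (auto simp: is_sup_def)
    moreover have "t \<preceq>\<^bsub>T\<^esub> s"
      using path_le_values[OF g'(3) g'(1) f a _ s] s t by (auto simp: is_sup_def)
    ultimately show ?thesis
      using s t T.le_antisym by (auto simp: is_sup_def)
  qed
  then have "endpoint T (path_class S T f) a = s"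
    unfolding endpoint_def using s path_class_self[OF f] by (intro the_equality) blast+
  then show ?thesis
    using s by simp
qed

lemma endpoint_closed:
  "\<lbrakk>x \<in> carrier (ihom S T); a \<in> carrier S\<rbrakk> \<Longrightarrow> endpoint T x a \<in> carrier T"
  using endpoint_is_sup by (auto simp: is_sup_def elim!: ihom_cases)

lemma endpoint_upper:
  "\<lbrakk>f \<in> paths S T; a \<in> carrier S; l \<in> I_Q\<rbrakk> \<Longrightarrow> f l a \<preceq>\<^bsub>T\<^esub> endpoint T (path_class S T f) a"
  using endpoint_is_sup[of f a] by (auto simp: is_sup_def)

lemma endpoint_least:
  assumes "f \<in> paths S T" "a \<in> carrier S" "u \<in> carrier T" "\<And>l. l \<in> I_Q \<Longrightarrow> f l a \<preceq>\<^bsub>T\<^esub> u"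
  shows "endpoint T (path_class S T f) a \<preceq>\<^bsub>T\<^esub> u"
  using endpoint_is_sup[OF assms(1,2)] assms(3,4) by (auto simp: is_sup_def)

text \<open>The truncation takes values of \<open>f\<close> at indices below \<open>m\<close> only.
  A path need not be continuous at \<open>m\<close>, so the endpoint is only enclosed between
  \<open>f m\<close> and the earlier values.\<close>

lemma endpoint_trunc_le:
  assumes "f \<in> paths S T" "a \<in> carrier S" "m \<in> I_Q"
  shows "endpoint T (path_class S T (trunc m f)) a \<preceq>\<^bsub>T\<^esub> f m a"
  using endpoint_least[OF trunc_paths[OF assms(1,3)] assms(2) paths_closed[OF assms(1,3,2)]]
    paths_le[OF assms(1) I_Q_mult[OF assms(3)] assms(3) _ assms(2)] mult_I_Q_less[OF assms(3)]
  by (simp add: trunc_def less_imp_le)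

lemma endpoint_trunc_ge:
  assumes "f \<in> paths S T" "a \<in> carrier S" "m \<in> I_Q" "l \<in> I_Q" "l < m"
  shows "f l a \<preceq>\<^bsub>T\<^esub> endpoint T (path_class S T (trunc m f)) a"
  using endpoint_upper[OF trunc_paths] trunc_index[OF assms(3-5), of f] assms by metis

text \<open>Passing to a larger index first gains \<open>prec\<close>; the value there is below the
  endpoint and thus pointwise below \<open>\<phi>\<close>.\<close>

lemma prec_if_endpoint_le:
  assumes f: "f \<in> paths S T" and h: "\<phi> \<in> gen_cu_hom S T"
    and le: "\<And>a. a \<in> carrier S \<Longrightarrow> endpoint T (path_class S T f) a \<preceq>\<^bsub>T\<^esub> \<phi> a"
    and l: "l \<in> I_Q"
  shows "prec S T (f l) \<phi>"
proof -
  have "l < (l + 1) / 2"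
    using l by (simp add: I_Q_def)
  then have "prec S T (f l) (f ((l + 1) / 2))"
    using paths_prec[OF f _ l I_Q_midpoint[OF l]] by blast
  moreover have "f ((l + 1) / 2) a \<preceq>\<^bsub>T\<^esub> \<phi> a" if "a \<in> carrier S" for a
  proof (rule T.le_trans)
    show "f ((l + 1) / 2) a \<preceq>\<^bsub>T\<^esub> endpoint T (path_class S T f) a"
      using endpoint_upper[OF f that I_Q_midpoint[OF l]] .
    show "f ((l + 1) / 2) a \<in> carrier T"
      using paths_closed[OF f I_Q_midpoint[OF l] that] .
    show "endpoint T (path_class S T f) a \<in> carrier T"
      using endpoint_closed[OF path_class_closed[OF f] that] .
  qed (use le h that gen_cu_hom_closed[OF h] in blast)+
  ultimately show ?thesis
    using prec_le_trans[OF _ _ h] by blast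
qed

text \<open>The truncations of \<open>h\<close> have supremum \<open>[h]\<close>, so
  \<open>x\<close> lies below one of them, and all values of that truncation are \<open>prec\<close>
  \<open>h m\<close>.\<close>

lemma way_below_endpoint:
  assumes "way_below (ihom S T) x (path_class S T h)" and h: "h \<in> paths S T"
  obtains m where "m \<in> I_Q" "\<forall>a\<in>carrier S. endpoint T x a \<preceq>\<^bsub>T\<^esub> h m a"
proof -
  obtain f where f: "f \<in> paths S T" "x = path_class S T f"
    using assms(1) ihom_cases unfolding way_below_def by metis
  have "path_le S T h h"
    using path_le_refl[OF h] .
  then obtain n where n: "x \<preceq>\<^bsub>ihom S T\<^esub> path_class S T (trunc (rat_of_nat (Suc n) / rat_of_nat (n + 2)) h)"
    using assms(1) trunc_sequence[OF h] path_class_leq_iff[OF h h] unfolding way_below_def by blast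
  define m :: rat where "m = rat_of_nat (Suc n) / rat_of_nat (n + 2)"
  have m: "m \<in> I_Q"
    unfolding m_def by (rule I_Q_seq)
  have le: "path_le S T f (trunc m h)"
    using n f path_class_leq_iff[OF f(1) trunc_paths[OF h m]] by (simp add: m_def)
  have "endpoint T x a \<preceq>\<^bsub>T\<^esub> h m a" if a: "a \<in> carrier S" for a
    unfolding f(2)
  proof (rule endpoint_least[OF f(1) a])
    show ma: "h m a \<in> carrier T"
      using paths_closed[OF h m a] .
    fix l assume l: "l \<in> I_Q"
    obtain k where k: "k \<in> I_Q" "prec S T (f l) (trunc m h k)"
      using le l by (auto simp: path_le_def)
    have "prec S T (f l) (h m)"
      by (rule prec_trans[OF k(2) trunc_prec[OF h m k(1)]
          paths_gen_cu_hom[OF trunc_paths[OF h m] k(1)] paths_gen_cu_hom[OF h m]])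
    then show "f l a \<preceq>\<^bsub>T\<^esub> h m a"
      by (rule prec_le[OF _ paths_gen_cu_hom[OF f(1) l] paths_gen_cu_hom[OF h m] a])
  qed
  then show ?thesis
    using m that by blast
qed

end

section \<open>The composition product\<close>

theorem proposition3p18:
  fixes S :: "'s posg" and T :: "'t posg" and P :: "'p posg"
    and f :: "rat \<Rightarrow> 's \<Rightarrow> 't" and g :: "rat \<Rightarrow> 't \<Rightarrow> 'p"
    \<comment> \<open>\<open>K = [T,P] \<otimes> [S,T]\<close>, \<open>X = [S,T] \<otimes> S\<close>, \<open>Y = [T,P] \<otimes> T\<close>,
        \<open>R = [T,P] \<otimes> ([S,T] \<otimes> S)\<close>, \<open>L = ([T,P] \<otimes> [S,T]) \<otimes> S\<close>\<close>
    and K :: "'k posg" and t_K :: "(rat \<Rightarrow> 't \<Rightarrow> 'p) set \<Rightarrow> (rat \<Rightarrow> 's \<Rightarrow> 't) set \<Rightarrow> 'k"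
    and X :: "'x posg" and t_X :: "(rat \<Rightarrow> 's \<Rightarrow> 't) set \<Rightarrow> 's \<Rightarrow> 'x"
    and Y :: "'y posg" and t_Y :: "(rat \<Rightarrow> 't \<Rightarrow> 'p) set \<Rightarrow> 't \<Rightarrow> 'y"
    and R :: "'r posg" and t_R :: "(rat \<Rightarrow> 't \<Rightarrow> 'p) set \<Rightarrow> 'x \<Rightarrow> 'r"
    and L :: "'l posg" and t_L :: "'k \<Rightarrow> 's \<Rightarrow> 'l"
    and e_ST :: "'x \<Rightarrow> 't" and e_TP :: "'y \<Rightarrow> 'p" and id_e :: "'r \<Rightarrow> 'y"
    and assoc :: "'l \<Rightarrow> 'r" and comp :: "'k \<Rightarrow> (rat \<Rightarrow> 's \<Rightarrow> 'p) set"
  assumes "cu_semigroup S" and "cu_semigroup T" and "cu_semigroup P"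
    and "f \<in> paths S T" and "g \<in> paths T P"
  shows "(\<lambda>l. g l \<circ> f l) \<in> paths S P \<and>
    (is_tensor_product TYPE((rat \<Rightarrow> 's \<Rightarrow> 'p) set) (ihom T P) (ihom S T) K t_K \<and>
     is_tensor_product TYPE('t) (ihom S T) S X t_X \<and>
     is_tensor_product TYPE('p) (ihom T P) T Y t_Y \<and>
     is_tensor_product TYPE('y) (ihom T P) X R t_R \<and>
     is_tensor_product TYPE('r) K S L t_L \<and>
     is_tensor_product TYPE('p) K S L t_L \<and>
     is_evaluation S T X t_X e_ST \<and>
     is_evaluation T P Y t_Y e_TP \<and>
     is_tensor_map (ihom T P) X R t_R Y t_Y id e_ST id_e \<and>
     is_associator (ihom T P) (ihom S T) S t_K L t_L t_X R t_R assoc \<and>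
     adjoint_pair K S P L t_L comp (e_TP \<circ> id_e \<circ> assoc)
     \<longrightarrow> comp (t_K (path_class T P g) (path_class S T f)) = path_class S P (\<lambda>l. g l \<circ> f l))"
proof -
  interpret ST: cu_semigroup_pair S T
    by (rule cu_semigroup_pair.intro) fact+
  interpret TP: cu_semigroup_pair T P
    by (rule cu_semigroup_pair.intro) fact+
  interpret SP: cu_semigroup_pair S P
    by (rule cu_semigroup_pair.intro) fact+
  note f = \<open>f \<in> paths S T\<close> and g = \<open>g \<in> paths T P\<close>
  define gf where "gf = (\<lambda>l. g l \<circ> f l)"
  have gf: "gf \<in> paths S P"
    unfolding gf_def using paths_comp f g .
  have "comp (t_K (path_class T P g) (path_class S T f)) = path_class S P gf"
    if K: "cu_semigroup K" and
      tK: "cu_bimorphism (ihom T P) (ihom S T) K t_K" and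
      tX: "cu_bimorphism (ihom S T) S X t_X" and
      eST: "is_evaluation S T X t_X e_ST" and
      eTP: "is_evaluation T P Y t_Y e_TP" and
      ide: "is_tensor_map (ihom T P) X R t_R Y t_Y id e_ST id_e" and
      asc: "is_associator (ihom T P) (ihom S T) S t_K L t_L t_X R t_R assoc" and
      adj: "adjoint_pair K S P L t_L comp (e_TP \<circ> id_e \<circ> assoc)"
  proof -
    have comp_hom: "comp \<in> cu_hom K (ihom S P)"
      using adj by (simp add: adjoint_pair_def)
    have K_closed: "t_K y x \<in> carrier K" if "y \<in> carrier (ihom T P)" "x \<in> carrier (ihom S T)" for y x
      using tK that by (simp add: cu_bimorphism_def)
    \<comment> \<open>The maps are unwound on simple tensors: the adjunction, the associator,
      \<open>id_e\<close> and the two evaluations. This determines only the endpoint of the product,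
      not yet its class.\<close>
    have end_comp: "endpoint P (comp (t_K y x)) a = endpoint P y (endpoint T x a)"
      if y: "y \<in> carrier (ihom T P)" and x: "x \<in> carrier (ihom S T)" and a: "a \<in> carrier S" for y x a
    proof -
      have xa: "t_X x a \<in> carrier X"
        using tX x a by (simp add: cu_bimorphism_def)
      have "endpoint P (comp (t_K y x)) a = e_TP (id_e (assoc (t_L (t_K y x) a)))"
        using adj K_closed[OF y x] a by (simp add: adjoint_pair_def)
      also have "\<dots> = e_TP (id_e (t_R y (t_X x a)))"
        using asc y x a by (simp add: is_associator_def)
      also have "\<dots> = e_TP (t_Y y (e_ST (t_X x a)))"
        using ide y xa by (simp add: is_tensor_map_def)
      also have "\<dots> = e_TP (t_Y y (endpoint T x a))"
        using eST x a by (simp add: is_evaluation_def adjoint_pair_def)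
      also have "\<dots> = endpoint P y (endpoint T x a)"
        using eTP y ST.endpoint_closed[OF x a] by (simp add: is_evaluation_def adjoint_pair_def)
      finally show ?thesis .
    qed
    define q :: "nat \<Rightarrow> rat" where "q n = rat_of_nat (Suc n) / rat_of_nat (n + 2)" for n
    have q: "q n \<in> I_Q" for n
      unfolding q_def by (rule I_Q_seq)
    define F where "F n = path_class S T (trunc (q n) f)" for n
    define G where "G n = path_class T P (trunc (q n) g)" for n
    have F: "F n \<in> carrier (ihom S T)" and G: "G n \<in> carrier (ihom T P)" for n
      unfolding F_def G_def using f g q trunc_paths ST.path_class_closed TP.path_class_closed by blast+
    have F_sup: "increasing (ihom S T) F" "is_sup (ihom S T) (range F) (path_class S T f)"
      using ST.trunc_sequence[OF f] unfolding F_def q_def by auto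
    have G_sup: "increasing (ihom T P) G" "is_sup (ihom T P) (range G) (path_class T P g)"
      using TP.trunc_sequence[OF g] unfolding G_def q_def by auto
    have FG_below: "way_below (ihom S P) (comp (t_K (G n) (F n)))
        (comp (t_K (path_class T P g) (path_class S T f)))" for n
    proof -
      have "way_below K (t_K (G n) (F n)) (t_K (path_class T P g) (path_class S T f))"
        using tK ST.way_below_trunc[OF f q] TP.way_below_trunc[OF g q]
        unfolding F_def G_def cu_bimorphism_def by blast
      then show ?thesis
        using comp_hom by (simp add: cu_hom_def)
    qed
    \<comment> \<open>The endpoint of \<open>F n\<close> is compared first, inside the monotone
      \<open>g l\<close>, and then that of \<open>G n\<close>. \<open>FG_upper\<close> follows the
      same pattern with \<open>q n\<close> for \<open>l\<close>.\<close>
    have FG_lower: "g l (f l a) \<preceq>\<^bsub>P\<^esub> endpoint P (comp (t_K (G n) (F n))) a"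
      if l: "l \<in> I_Q" "l < q n" and a: "a \<in> carrier S" for l n a
    proof -
      have fa: "f l a \<in> carrier T" and Fa: "endpoint T (F n) a \<in> carrier T"
        using paths_closed[OF f l(1) a] ST.endpoint_closed[OF F a] by blast+
      have gl: "g l \<in> gen_cu_hom T P"
        using g l paths_gen_cu_hom by blast
      have "f l a \<preceq>\<^bsub>T\<^esub> endpoint T (F n) a"
        unfolding F_def using ST.endpoint_trunc_ge[OF f a q l] .
      then have "g l (f l a) \<preceq>\<^bsub>P\<^esub> g l (endpoint T (F n) a)"
        using gen_cu_hom_mono[OF gl _ fa Fa] by blast
      moreover have "g l (endpoint T (F n) a) \<preceq>\<^bsub>P\<^esub> endpoint P (G n) (endpoint T (F n) a)"
        unfolding G_def using TP.endpoint_trunc_ge[OF g Fa q l] .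
      ultimately show ?thesis
        unfolding end_comp[OF G F a]
        by (rule TP.T.le_trans[OF _ _ gen_cu_hom_closed[OF gl fa] gen_cu_hom_closed[OF gl Fa]
              TP.endpoint_closed[OF G Fa]])
    qed
    have FG_upper: "endpoint P (comp (t_K (G n) (F n))) a \<preceq>\<^bsub>P\<^esub> g (q n) (f (q n) a)"
      if a: "a \<in> carrier S" for n a
    proof -
      have fa: "f (q n) a \<in> carrier T" and Fa: "endpoint T (F n) a \<in> carrier T"
        using paths_closed[OF f q a] ST.endpoint_closed[OF F a] by blast+
      have gq: "g (q n) \<in> gen_cu_hom T P"
        using g q paths_gen_cu_hom by blast
      have "endpoint T (F n) a \<preceq>\<^bsub>T\<^esub> f (q n) a"
        unfolding F_def using ST.endpoint_trunc_le[OF f a q] .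
      then have "g (q n) (endpoint T (F n) a) \<preceq>\<^bsub>P\<^esub> g (q n) (f (q n) a)"
        using gen_cu_hom_mono[OF gq _ Fa fa] by blast
      moreover have "endpoint P (G n) (endpoint T (F n) a) \<preceq>\<^bsub>P\<^esub> g (q n) (endpoint T (F n) a)"
        unfolding G_def using TP.endpoint_trunc_le[OF g Fa q] .
      ultimately show ?thesis
        unfolding end_comp[OF G F a]
        using TP.T.le_trans[OF _ _ TP.endpoint_closed[OF G Fa] gen_cu_hom_closed[OF gq Fa]
            gen_cu_hom_closed[OF gq fa]] by blast
    qed
    obtain h where h: "h \<in> paths S P"
      "comp (t_K (path_class T P g) (path_class S T f)) = path_class S P h"
      using FG_below SP.ihom_cases unfolding way_below_def by metis
    have "path_le S P gf h"
      unfolding path_le_def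
    proof
      fix l assume l: "l \<in> I_Q"
      \<comment> \<open>The comparison through endpoints is only pointwise. It is made at
        \<open>l'\<close>, so that the step from \<open>l\<close> to \<open>l'\<close> supplies
        \<open>prec\<close>.\<close>
      define l' where "l' = (l + 1) / 2"
      have l': "l' \<in> I_Q" "l < l'"
        using l unfolding l'_def by (auto simp: I_Q_def)
      obtain n where n: "l' < q n"
        using I_Q_seq_cofinal[OF l'(1)] unfolding q_def by blast
      have below: "way_below (ihom S P) (comp (t_K (G n) (F n))) (path_class S P h)"
        using FG_below h(2) by metis
      obtain m where m: "m \<in> I_Q"
        "\<forall>a\<in>carrier S. endpoint P (comp (t_K (G n) (F n))) a \<preceq>\<^bsub>P\<^esub> h m a"
        using SP.way_below_endpoint[OF below h(1)] by blast
      have "gf l' a \<preceq>\<^bsub>P\<^esub> h m a" if a: "a \<in> carrier S" for a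
      proof (rule TP.T.le_trans)
        show "gf l' a \<preceq>\<^bsub>P\<^esub> endpoint P (comp (t_K (G n) (F n))) a"
          using FG_lower[OF l'(1) n a] by (simp add: gf_def)
        show "endpoint P (comp (t_K (G n) (F n))) a \<in> carrier P"
          using below SP.endpoint_closed[OF _ a] by (simp add: way_below_def)
        show "gf l' a \<in> carrier P" "h m a \<in> carrier P"
          using paths_closed[OF gf l'(1) a] paths_closed[OF h(1) m(1) a] .
      qed (use m(2) a in blast)
      then have "prec S P (gf l) (h m)"
        by (rule SP.prec_le_trans[OF paths_prec[OF gf l'(2) l l'(1)] _ paths_gen_cu_hom[OF h(1) m(1)]])
      then show "\<exists>m\<in>I_Q. prec S P (gf l) (h m)"
        using m(1) by blast
    qed
    moreover have "path_class S P h \<preceq>\<^bsub>ihom S P\<^esub> path_class S P gf"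
    proof -
      \<comment> \<open>One diagonal sequence suffices, since a Cu-bimorphism preserves suprema in
        both variables at once. Monotonicity is checked by changing one argument at a time.\<close>
      have "increasing K (\<lambda>n. t_K (G n) (F n))"
        unfolding increasing_def
      proof (intro allI conjI)
        fix n
        show "t_K (G n) (F n) \<in> carrier K"
          using K_closed F G by blast
        have "t_K (G n) (F n) \<preceq>\<^bsub>K\<^esub> t_K (G (Suc n)) (F n)"
          "t_K (G (Suc n)) (F n) \<preceq>\<^bsub>K\<^esub> t_K (G (Suc n)) (F (Suc n))"
          using tK F_sup(1) G_sup(1) F G unfolding cu_bimorphism_def increasing_def by blast+
        then show "t_K (G n) (F n) \<preceq>\<^bsub>K\<^esub> t_K (G (Suc n)) (F (Suc n))"
          using pos_ordered_semigroup.le_trans[OF cu_semigroup.axioms(1)[OF K]] K_closed F G by blast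
      qed
      moreover have "is_sup K (range (\<lambda>n. t_K (G n) (F n))) (t_K (path_class T P g) (path_class S T f))"
        using tK F_sup G_sup unfolding cu_bimorphism_def by blast
      ultimately have sup: "is_sup (ihom S P) (range (\<lambda>n. comp (t_K (G n) (F n)))) (path_class S P h)"
        unfolding h(2)[symmetric] using gen_cu_hom_sup comp_hom by (auto simp: cu_hom_def)
      have "comp (t_K (G n) (F n)) \<preceq>\<^bsub>ihom S P\<^esub> path_class S P gf" for n
      proof -
        obtain k where k: "k \<in> paths S P" "comp (t_K (G n) (F n)) = path_class S P k"
          using FG_below SP.ihom_cases unfolding way_below_def by metis
        \<comment> \<open>\<open>FG_upper\<close> bounds the endpoint of the \<open>n\<close>-th
          product by the single morphism \<open>gf (q n)\<close>, so the same index of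
          \<open>gf\<close> serves every \<open>l\<close>.\<close>
        have "prec S P (k l) (gf (q n))" if "l \<in> I_Q" for l
          using SP.prec_if_endpoint_le[OF k(1) paths_gen_cu_hom[OF gf q] _ that] FG_upper
          by (simp add: k(2)[symmetric] gf_def)
        then show ?thesis
          unfolding k(2) SP.path_class_leq_iff[OF k(1) gf] path_le_def using q by blast
      qed
      then show ?thesis
        using sup SP.path_class_closed[OF gf] by (auto simp: is_sup_def)
    qed
    ultimately show ?thesis
      using SP.path_class_eq[OF h(1) gf] SP.path_class_leq_iff[OF h(1) gf] h(2) by metis
  qed
  then show ?thesis
    using gf unfolding gf_def is_tensor_product_def by blast
qed

end
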